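(* Let $s\ge 0$. Then the minimum in the optimal control problem $$\min_{T\in\mathbb{R},\,K_k\in\mathbb{R}^{m\times n},\,\Phi_k\in\mathcal{V}^s}J(T,(K_k,\Phi_k)_{k=1}^{N_K})$$ subject to the constraints $$0\le T\le T_{\max},\qquad \alpha(K_k)\le 1,\qquad \beta(\Phi_k)\le 1,\qquad K_k\mathbf{1}=0\in\mathbb{R}^m\qquad (k=1,\dots,N_K)$$ and the state equation $$\dot x(t)=T\Big(-A^\top(Ax(t)-b)-\sum_{k=1}^{N_K}K_k^\top\Phi_k(K_kx(t))\Big)\quad\text{for } t\in(0,1),\qquad x(0)=x_0,$$ is attained.
   Context: Fixed data: positive integers $n,m,l,N_K$ and $N_w\ge 1$; a fixed $s\ge 0$; a matrix $A\in\mathbb{R}^{l\times n}$; vectors $b\in\mathbb{R}^l$ and $x_0,x_g\in\mathbb{R}^n$ (initial value and ground truth); a constant $T_{\max}>0$. $\mathbf{1}=(1,\dots,1)^\top\in\mathbb{R}^n$. Activation functions: fix a bounded open interval $I\subset\mathbb{R}$ and $C^s(\mathbb{R},\mathbb{R})$-conforming basis functions $\psi_1,\dots,\psi_{N_w}$ with compact support in $\overline I$. Define $$\mathcal{V}^s=\Big\{\Phi=(\phi,\dots,\phi):\mathbb{R}^m\to\mathbb{R}^m \;\Big|\; \phi=\sum_{j=1}^{N_w}w_j\psi_j\Big\},$$ with weight vectors $w\in\mathbb{R}^{N_w}$, where $\Phi$ consists of $m$ identical component functions and acts componentwise, $\Phi(y_1,\dots,y_m)=(\phi(y_1),\dots,\phi(y_m))^\top$.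 $\|\cdot\|$ denotes a norm on $\mathbb{R}^{m\times n}$ and on $\mathcal{V}^s$, respectively. Constraint functions: $\alpha:\mathbb{R}^{m\times n}\to\mathbb{R}_0^+=[0,\infty)$ and $\beta:\mathcal{V}^s\to\mathbb{R}_0^+$ are continuously differentiable functions with non-vanishing gradient such that $\alpha(K)\to\infty$ and $\beta(\Phi)\to\infty$ as $\|K\|\to\infty$ and $\|\Phi\|\to\infty$. Cost functional: $J(T,(K_k,\Phi_k)_{k=1}^{N_K})=\tfrac12\|x(1)-x_g\|_2^2$, where $x$ is the state associated with the controls $T$, $(K_k,\Phi_k)_{k=1}^{N_K}$ through the state equation with initial condition $x(0)=x_0$.
   Formalization: A non-vanishing gradient contradicts coercivity, so it is only required where α=1 (β=1) away from global minimizers; existence of admissible controls is assumed, since e.g. α(K)=2+‖K‖² allows none. For s=0 the minimum also ranges over the associated states. *)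

theory Defs
  imports "HOL-Analysis.Analysis"
begin

definition Cs_function :: "nat \<Rightarrow> (real \<Rightarrow> real) \<Rightarrow> bool" where
  "Cs_function s f \<longleftrightarrow>
     (\<forall>j<s. \<forall>t. ((deriv ^^ j) f) field_differentiable (at t)) \<and>
     continuous_on UNIV ((deriv ^^ s) f)"

definition basis_functions :: "nat \<Rightarrow> real set \<Rightarrow> ('w::finite \<Rightarrow> real \<Rightarrow> real) \<Rightarrow> bool" where
  "basis_functions s I \<psi> \<longleftrightarrow>
     (\<forall>j. Cs_function s (\<psi> j)) \<and>
     (\<forall>j. compact (closure {t. \<psi> j t \<noteq> 0}) \<and> closure {t. \<psi> j t \<noteq> 0} \<subseteq> closure I) \<and>
     (\<forall>w::real^'w. (\<forall>t. (\<Sum>j\<in>UNIV. w $ j * \<psi> j t) = 0) \<longrightarrow> w = 0)"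

definition activation ::
    "('w::finite \<Rightarrow> real \<Rightarrow> real) \<Rightarrow> real^'w \<Rightarrow> real^'m \<Rightarrow> real^'m" where
  "activation \<psi> w = (\<lambda>y. \<chi> i. \<Sum>j\<in>UNIV. w $ j * \<psi> j (y $ i))"

definition activation_space ::
    "('w::finite \<Rightarrow> real \<Rightarrow> real) \<Rightarrow> (real^'m \<Rightarrow> real^'m) set" where
  "activation_space \<psi> = range (activation \<psi>)"

definition is_norm :: "('a::real_vector \<Rightarrow> real) \<Rightarrow> bool" where
  "is_norm N \<longleftrightarrow>
     (\<forall>x. 0 \<le> N x) \<and> (\<forall>x. N x = 0 \<longleftrightarrow> x = 0) \<and>
     (\<forall>c x. N (c *\<^sub>R x) = \<bar>c\<bar> * N x) \<and> (\<forall>x y. N (x + y) \<le> N x + N y)"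

text \<open>Function types carry no vector space instance, so the pointwise operations
  are written out. Values of \<open>N\<close> outside \<open>V\<close> are irrelevant.\<close>

definition is_norm_on_functions ::
    "('a \<Rightarrow> 'b::real_vector) set \<Rightarrow> (('a \<Rightarrow> 'b) \<Rightarrow> real) \<Rightarrow> bool" where
  "is_norm_on_functions V N \<longleftrightarrow>
     (\<forall>\<Phi>\<in>V. 0 \<le> N \<Phi>) \<and> (\<forall>\<Phi>\<in>V. N \<Phi> = 0 \<longleftrightarrow> (\<forall>y. \<Phi> y = 0)) \<and>
     (\<forall>c. \<forall>\<Phi>\<in>V. N (\<lambda>y. c *\<^sub>R \<Phi> y) = \<bar>c\<bar> * N \<Phi>) \<and>
     (\<forall>\<Phi>\<in>V. \<forall>\<Psi>\<in>V. N (\<lambda>y. \<Phi> y + \<Psi> y) \<le> N \<Phi> + N \<Psi>)"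

text \<open>Nonnegative, continuously differentiable, coercive with respect to \<open>N\<close>, and with
  non-vanishing gradient. A coercive \<open>C\<^sup>1\<close> function on a Euclidean space attains its minimum,
  where its gradient is zero; a gradient that vanishes nowhere would therefore be contradictory.
  It is required to be nonzero where the constraint \<open>f x \<le> 1\<close> is active, except at a
  global minimizer.\<close>

definition constraint_function :: "('a::euclidean_space \<Rightarrow> real) \<Rightarrow> ('a \<Rightarrow> real) \<Rightarrow> bool" where
  "constraint_function N f \<longleftrightarrow>
     (\<forall>x. 0 \<le> f x) \<and>
     (\<exists>g. (\<forall>x. GDERIV f x :> g x) \<and> continuous_on UNIV g \<and>
          (\<forall>x. f x = 1 \<and> (\<exists>y. f y < f x) \<longrightarrow> g x \<noteq> 0)) \<and>
     filterlim f at_top (filtercomap N at_top)"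

text \<open>For linearly independent \<open>\<psi>\<close> the map \<open>activation \<psi>\<close> is a linear isomorphism from
  the weight space onto \<open>activation_space \<psi>\<close>. Differentiability, non-vanishing of the gradient
  and coercivity do not depend on the choice of linear coordinates, so they are
  expressed through the weights.\<close>

definition activation_constraint_function ::
    "('w::finite \<Rightarrow> real \<Rightarrow> real) \<Rightarrow> ((real^'m \<Rightarrow> real^'m) \<Rightarrow> real) \<Rightarrow>
     ((real^'m \<Rightarrow> real^'m) \<Rightarrow> real) \<Rightarrow> bool" where
  "activation_constraint_function \<psi> N \<beta> \<longleftrightarrow>
     constraint_function (\<lambda>w. N (activation \<psi> w)) (\<lambda>w. \<beta> (activation \<psi> w))"

definition admissible_controls ::
    "('w::finite \<Rightarrow> real \<Rightarrow> real) \<Rightarrow> real \<Rightarrow> (real^'n^'m \<Rightarrow> real) \<Rightarrow>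
     ((real^'m \<Rightarrow> real^'m) \<Rightarrow> real) \<Rightarrow>
     real \<Rightarrow> ('k \<Rightarrow> real^'n^'m) \<Rightarrow> ('k \<Rightarrow> real^'m \<Rightarrow> real^'m) \<Rightarrow> bool" where
  "admissible_controls \<psi> Tmax \<alpha> \<beta> T K \<Phi> \<longleftrightarrow>
     0 \<le> T \<and> T \<le> Tmax \<and>
     (\<forall>k. \<Phi> k \<in> activation_space \<psi> \<and> \<alpha> (K k) \<le> 1 \<and> \<beta> (\<Phi> k) \<le> 1 \<and> K k *v vec 1 = 0)"

text \<open>The state is defined on \<open>[0,1]\<close>; continuity there ties the values at the end points to the
  differential equation on the open interval. For \<open>s = 0\<close> a control may have several states.\<close>

definition is_state ::
    "real^'n^'l \<Rightarrow> real^'l \<Rightarrow> real^'n \<Rightarrow> real \<Rightarrow> ('k::finite \<Rightarrow> real^'n^'m) \<Rightarrow>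
     ('k \<Rightarrow> real^'m \<Rightarrow> real^'m) \<Rightarrow> (real \<Rightarrow> real^'n) \<Rightarrow> bool" where
  "is_state A b x0 T K \<Phi> x \<longleftrightarrow>
     continuous_on {0..1} x \<and> x 0 = x0 \<and>
     (\<forall>t\<in>{0<..<1}. (x has_vector_derivative
        T *\<^sub>R (- (transpose A *v (A *v x t - b))
             - (\<Sum>k\<in>UNIV. transpose (K k) *v \<Phi> k (K k *v x t)))) (at t))"

definition cost :: "real^'n \<Rightarrow> (real \<Rightarrow> real^'n) \<Rightarrow> real" where
  "cost xg x = 1 / 2 * (norm (x 1 - xg))\<^sup>2"

end

theory Submission
  imports Defs "HOL-Complex_Analysis.Great_Picard"
begin

text \<open>The proof is the direct method. A minimizing sequence of controls lies in a compact set: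
  coercivity of \<open>\<alpha>\<close> and \<open>\<beta>\<close> bounds the matrices and the weight vectors (all norms on these
  Euclidean spaces dominate the Euclidean one), and the constraints are closed because \<open>\<alpha>\<close> and
  \<open>\<beta>\<close> are continuous. What remains is that limits of states are states of limiting controls.

  For \<open>s = 0\<close> the vector field is merely continuous, so states need not be unique and
  continuous dependence on the controls is not available. It is replaced by compactness. The
  energy identity bounds all states simultaneously: the linear part contributes
  \<open>- \<parallel>A x\<parallel>\<^sup>2 + A x \<bullet> b \<le> \<parallel>b\<parallel>\<^sup>2\<close>, and \<open>K\<^sup>T \<Phi> (K x)\<close> paired with \<open>x\<close> is
  \<open>y \<bullet> \<Phi> y\<close> for \<open>y = K x\<close>, which is bounded because the functions \<open>t \<mapsto> t \<psi> t\<close> are continuous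
  with compact support (\<open>radial_component_bounded\<close>). On bounded sets the right-hand side
  is bounded as well, so the states are equi-Lipschitz; by Arzela and Ascoli a subsequence
  converges uniformly, and the integral form of the equation passes to the limit
  (\<open>trajectories_subsequence_limit\<close>). Thus the set of reachable end points is compact
  (\<open>compact_reachable_set\<close>), and the cost, a continuous function of the end point, attains its
  minimum there. The reachable set is nonempty without any existence theory for differential
  equations: with \<open>T = 0\<close> the constant \<open>x0\<close> is a state.\<close>

section \<open>Compactness of reachable sets\<close>

definition trajectory :: "('a::real_normed_vector \<Rightarrow> 'a) \<Rightarrow> 'a \<Rightarrow> (real \<Rightarrow> 'a) \<Rightarrow> bool" where
  "trajectory g x0 x \<longleftrightarrow> continuous_on {0..1} x \<and> x 0 = x0 \<and>
     (\<forall>t\<in>{0<..<1}. (x has_vector_derivative g (x t)) (at t))"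

text \<open>The derivative of \<open>\<parallel>x\<parallel>\<^sup>2\<close> is \<open>2 (x \<bullet> g x)\<close>, so a one-sided bound on the radial component
  of the field replaces any growth condition.\<close>

lemma trajectory_energy_bound:
  fixes g :: "'a::real_inner \<Rightarrow> 'a"
  assumes x: "trajectory g x0 x" and C: "\<And>y. y \<bullet> g y \<le> C" and t: "t \<in> {0..1}"
  shows "(norm (x t))\<^sup>2 \<le> (norm x0)\<^sup>2 + 2 * \<bar>C\<bar>"
proof -
  have cont: "continuous_on {0..t} x"
    using x t by (auto simp: trajectory_def intro: continuous_on_subset)
  have deriv: "((\<lambda>r. x r \<bullet> x r - 2 * C * r) has_real_derivative 2 * (x u \<bullet> g (x u)) - 2 * C) (at u)"
    if "0 < u" "u < t" for u
  proof -
    have "(x has_derivative (\<lambda>h. h *\<^sub>R g (x u))) (at u)"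
      using x t that by (auto simp: trajectory_def has_vector_derivative_def)
    then show ?thesis
      unfolding has_field_derivative_def
      by (auto intro!: derivative_eq_intros simp: inner_commute algebra_simps)
  qed
  have "x t \<bullet> x t - 2 * C * t \<le> x 0 \<bullet> x 0 - 2 * C * 0"
  proof (rule DERIV_nonpos_imp_decreasing_open[of 0 t "\<lambda>r. x r \<bullet> x r - 2 * C * r"])
    show "\<exists>y. ((\<lambda>r. x r \<bullet> x r - 2 * C * r) has_real_derivative y) (at u) \<and> y \<le> 0"
      if "0 < u" "u < t" for u
      using deriv[OF that] C[of "x u"] by fastforce
    show "continuous_on {0..t} (\<lambda>r. x r \<bullet> x r - 2 * C * r)"
      using cont by (intro continuous_intros)
  qed (use t in auto)
  moreover have "C * t \<le> \<bar>C\<bar>"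
  proof -
    have "C * t \<le> \<bar>C\<bar> * t" using t by (intro mult_right_mono) auto
    also have "\<dots> \<le> \<bar>C\<bar> * 1" using t by (intro mult_left_mono) auto
    finally show ?thesis by simp
  qed
  ultimately show ?thesis
    using x by (simp add: trajectory_def power2_norm_eq_inner)
qed

lemma trajectory_Lipschitz:
  fixes g :: "'a::real_inner \<Rightarrow> 'a"
  assumes x: "trajectory g x0 x" and L: "\<And>t. t \<in> {0..1} \<Longrightarrow> norm (g (x t)) \<le> L"
    and "u \<in> {0..1}" "v \<in> {0..1}"
  shows "norm (x u - x v) \<le> L * \<bar>u - v\<bar>"
proof -
  have *: "norm (x d - x c) \<le> L * (d - c)" if "0 \<le> c" "c < d" "d \<le> 1" for c d
  proof -
    have "\<exists>r\<in>{c<..<d}. norm (x d - x c) \<le> norm ((d - c) *\<^sub>R g (x r))"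
    proof (rule mvt_general[OF \<open>c < d\<close>])
      show "continuous_on {c..d} x"
        using x that by (auto simp: trajectory_def intro: continuous_on_subset)
      show "(x has_derivative (\<lambda>h. h *\<^sub>R g (x r))) (at r)" if "c < r" "r < d" for r
        using x that \<open>0 \<le> c\<close> \<open>d \<le> 1\<close> by (auto simp: trajectory_def has_vector_derivative_def)
    qed
    then obtain r where r: "r \<in> {c<..<d}" "norm (x d - x c) \<le> norm ((d - c) *\<^sub>R g (x r))"
      by blast
    have "norm (g (x r)) \<le> L" using r that by (intro L) auto
    then have "(d - c) * norm (g (x r)) \<le> (d - c) * L" using that by (intro mult_left_mono) auto
    moreover have "norm (x d - x c) \<le> (d - c) * norm (g (x r))" using r(2) that by simp
    ultimately have "norm (x d - x c) \<le> (d - c) * L" by (rule order_trans[rotated])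
    then show ?thesis by (simp only: mult.commute)
  qed
  show ?thesis
    using *[of u v] *[of v u] assms(3,4)
    by (cases u v rule: linorder_cases) (auto simp: norm_minus_commute)
qed

lemma trajectory_integral:
  fixes g :: "'a::banach \<Rightarrow> 'a"
  assumes x: "trajectory g x0 x" and t: "t \<in> {0..1}"
  shows "((\<lambda>r. g (x r)) has_integral (x t - x0)) {0..t}"
proof -
  have "((\<lambda>r. g (x r)) has_integral (x t - x 0)) {0..t}"
    by (rule fundamental_theorem_of_calculus_interior)
       (use x t in \<open>auto simp: trajectory_def intro: continuous_on_subset\<close>)
  then show ?thesis using x by (simp add: trajectory_def)
qed

lemma trajectory_of_integral:
  fixes g :: "'a::banach \<Rightarrow> 'a"
  assumes g: "continuous_on UNIV g" and x: "continuous_on {0..1} x"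
    and eq: "\<And>t. t \<in> {0..1} \<Longrightarrow> x t = x0 + integral {0..t} (\<lambda>r. g (x r))"
  shows "trajectory g x0 x"
  unfolding trajectory_def
proof (intro conjI ballI)
  have cont: "continuous_on {0..1} (\<lambda>r. g (x r))"
    by (rule continuous_on_compose2[OF g x]) auto
  fix t :: real assume t: "t \<in> {0<..<1}"
  have "((\<lambda>u. x0 + integral {0..u} (\<lambda>r. g (x r))) has_vector_derivative g (x t)) (at t within {0..1})"
    using integral_has_vector_derivative[OF cont, of t] t
    by (auto intro!: derivative_eq_intros)
  then have "(x has_vector_derivative g (x t)) (at t within {0..1})"
  proof (rule has_vector_derivative_transform[rotated 2])
    show "t \<in> {0..1}" using t by simp
  qed (rule eq)
  then show "(x has_vector_derivative g (x t)) (at t)"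
    using t by (simp add: at_within_Icc_at)
qed (use x eq[of 0] in auto)

text \<open>No uniqueness of trajectories is assumed, so the limiting trajectory has to be extracted
  from the given ones: they are equi-Lipschitz, and the integral equation is stable under
  uniform convergence.\<close>

lemma trajectories_subsequence_limit:
  fixes f :: "'p::metric_space \<Rightarrow> 'a::euclidean_space \<Rightarrow> 'a"
  assumes P: "compact P" and f: "continuous_on (P \<times> UNIV) (\<lambda>(p, y). f p y)"
    and C: "\<And>p y. p \<in> P \<Longrightarrow> y \<bullet> f p y \<le> C"
    and p: "\<And>n::nat. p n \<in> P" and x: "\<And>n. trajectory (f (p n)) x0 (x n)"
  obtains q z and r :: "nat \<Rightarrow> nat" where "q \<in> P" "trajectory (f q) x0 z" "strict_mono r"
    "\<And>t. t \<in> {0..1} \<Longrightarrow> (\<lambda>n. x (r n) t) \<longlonglongrightarrow> z t"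
proof -
  obtain q r1 where q: "q \<in> P" and r1: "strict_mono r1" and plim: "(p \<circ> r1) \<longlonglongrightarrow> q"
    using P p unfolding compact_def by blast
  define R where "R = sqrt ((norm x0)\<^sup>2 + 2 * \<bar>C\<bar>)"
  have R: "norm (x n t) \<le> R" if "t \<in> {0..1}" for n t
    unfolding R_def using trajectory_energy_bound[OF x C that] p by (simp add: real_le_rsqrt)
  have "compact (P \<times> cball (0::'a) R)" using P by (intro compact_Times) auto
  moreover have "continuous_on (P \<times> cball 0 R) (\<lambda>(p, y). f p y)"
    by (rule continuous_on_subset[OF f]) auto
  ultimately have "bounded ((\<lambda>(p, y). f p y) ` (P \<times> cball 0 R))"
    by (intro compact_imp_bounded compact_continuous_image)
  then obtain L where "L > 0"
    and "\<forall>v\<in>(\<lambda>(p, y). f p y) ` (P \<times> cball 0 R). norm v \<le> L"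
    unfolding bounded_pos by blast
  then have L: "norm (f p y) \<le> L" if "p \<in> P" "norm y \<le> R" for p y
    using that by (auto dest: bspec[where x = "f p y"] intro!: image_eqI[where x = "(p, y)"])
  have Lip: "norm (x n u - x n v) \<le> L * \<bar>u - v\<bar>" if "u \<in> {0..1}" "v \<in> {0..1}" for n u v
    by (rule trajectory_Lipschitz[OF x L[OF p R] that])
  obtain z r2 where z: "continuous_on {0..1} z" and r2: "strict_mono (r2 :: nat \<Rightarrow> nat)"
    and unif: "\<And>e. 0 < e \<Longrightarrow> \<exists>N. \<forall>n t. n \<ge> N \<and> t \<in> {0..1} \<longrightarrow> norm (x (r1 (r2 n)) t - z t) < e"
  proof (rule Arzela_Ascoli[of "{0..1::real}" "\<lambda>n. x (r1 n)" R])
    show "\<exists>d>0. \<forall>n v. v \<in> {0..1} \<and> norm (u - v) < d \<longrightarrow> norm (x (r1 n) u - x (r1 n) v) < e"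
      if "u \<in> {0..1}" "0 < e" for u e
    proof (intro exI[of _ "e / L"] conjI allI impI)
      fix n v assume v: "v \<in> {0..1} \<and> norm (u - v) < e / L"
      then have "L * \<bar>u - v\<bar> < e" using \<open>L > 0\<close> by (simp add: field_simps)
      then show "norm (x (r1 n) u - x (r1 n) v) < e" using Lip[of u v "r1 n"] v that by auto
    qed (use \<open>L > 0\<close> that in auto)
    show "norm (x (r1 n) u) \<le> R" if "u \<in> {0..1}" for n u by (rule R[OF that])
  qed simp_all
  define r where "r = r1 \<circ> r2"
  have zlim: "(\<lambda>n. x (r n) t) \<longlonglongrightarrow> z t" if "t \<in> {0..1}" for t
    unfolding LIMSEQ_iff r_def o_apply using unif that by blast
  have plim': "(\<lambda>n. p (r n)) \<longlonglongrightarrow> q"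
    using LIMSEQ_subseq_LIMSEQ[OF plim r2] by (simp add: r_def o_def)
  have flim: "(\<lambda>n. f (p (r n)) (x (r n) t)) \<longlonglongrightarrow> f q (z t)" if "t \<in> {0..1}" for t
  proof -
    have "(\<lambda>n. (p (r n), x (r n) t)) \<longlonglongrightarrow> (q, z t)"
      by (intro tendsto_Pair plim' zlim that)
    then have "(\<lambda>n. (\<lambda>(p, y). f p y) (p (r n), x (r n) t)) \<longlonglongrightarrow> (\<lambda>(p, y). f p y) (q, z t)"
      by (rule continuous_on_tendsto_compose[OF f]) (use q p in auto)
    then show ?thesis by simp
  qed
  have "trajectory (f q) x0 z"
  proof (rule trajectory_of_integral[OF _ z])
    have "continuous_on UNIV (\<lambda>y. (\<lambda>(p, y). f p y) (q, y))"
      by (intro continuous_on_compose2[OF f] continuous_on_Pair continuous_on_const continuous_on_id)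
         (use q in auto)
    then show "continuous_on UNIV (f q)" by simp
    fix t :: real assume t: "t \<in> {0..1}"
    have int: "((\<lambda>u. f (p (r n)) (x (r n) u)) has_integral (x (r n) t - x0)) {0..t}" for n
      by (rule trajectory_integral[OF x t])
    have "(\<lambda>n. integral {0..t} (\<lambda>u. f (p (r n)) (x (r n) u))) \<longlonglongrightarrow> integral {0..t} (\<lambda>u. f q (z u))"
    proof (rule dominated_convergence(2)[where h = "\<lambda>_. L"])
      show "(\<lambda>u. f (p (r n)) (x (r n) u)) integrable_on {0..t}" for n
        using int by blast
      show "(\<lambda>_. L) integrable_on {0..t}" by (rule integrable_const_ivl)
      show "norm (f (p (r n)) (x (r n) u)) \<le> L" if "u \<in> {0..t}" for n u
        by (rule L[OF p R]) (use t that in auto)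
      show "(\<lambda>n. f (p (r n)) (x (r n) u)) \<longlonglongrightarrow> f q (z u)" if "u \<in> {0..t}" for u
        by (rule flim) (use t that in auto)
    qed
    then have "(\<lambda>n. x (r n) t - x0) \<longlonglongrightarrow> integral {0..t} (\<lambda>u. f q (z u))"
      by (simp only: integral_unique[OF int])
    moreover have "(\<lambda>n. x (r n) t - x0) \<longlonglongrightarrow> z t - x0"
      by (intro tendsto_intros zlim t)
    ultimately have "z t - x0 = integral {0..t} (\<lambda>u. f q (z u))"
      using LIMSEQ_unique by blast
    then show "z t = x0 + integral {0..t} (\<lambda>u. f q (z u))" by (simp add: algebra_simps)
  qed
  moreover have "strict_mono r" using r1 r2 by (auto simp: r_def strict_mono_o)
  ultimately show ?thesis using that q zlim by blast
qed

lemma compact_reachable_set: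
  fixes f :: "'p::metric_space \<Rightarrow> 'a::euclidean_space \<Rightarrow> 'a"
  assumes P: "compact P" and f: "continuous_on (P \<times> UNIV) (\<lambda>(p, y). f p y)"
    and C: "\<And>p y. p \<in> P \<Longrightarrow> y \<bullet> f p y \<le> C"
  shows "compact {x 1 | p x. p \<in> P \<and> trajectory (f p) x0 x}"
  unfolding compact_def
proof (intro allI impI)
  fix e :: "nat \<Rightarrow> 'a"
  assume "\<forall>n. e n \<in> {x 1 | p x. p \<in> P \<and> trajectory (f p) x0 x}"
  then have "\<forall>n. \<exists>p x. e n = x 1 \<and> p \<in> P \<and> trajectory (f p) x0 x" by blast
  then obtain p x where e: "\<And>n. e n = x n 1" and p: "\<And>n. p n \<in> P"
    and x: "\<And>n. trajectory (f (p n)) x0 (x n)" by metis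
  obtain q z r where "q \<in> P" "trajectory (f q) x0 z" "strict_mono r"
    and lim: "\<And>t. t \<in> {0..1} \<Longrightarrow> (\<lambda>n. x (r n) t) \<longlonglongrightarrow> z t"
    using trajectories_subsequence_limit[where p = p and x = x, OF P f C p x] by metis
  moreover have "(e \<circ> r) \<longlonglongrightarrow> z 1" using lim[of 1] by (simp add: e o_def)
  ultimately show "\<exists>l\<in>{x 1 | p x. p \<in> P \<and> trajectory (f p) x0 x}.
      \<exists>r. strict_mono r \<and> (e \<circ> r) \<longlonglongrightarrow> l"
    by blast
qed

section \<open>Compactness of constraint sets\<close>

text \<open>One half of the equivalence of norms in finite dimension: a norm is continuous, hence bounded
  away from zero on the Euclidean unit sphere.\<close>

lemma is_norm_dominates_norm:
  fixes N :: "'a::euclidean_space \<Rightarrow> real"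
  assumes "is_norm N"
  obtains c where "c > 0" "\<And>x. c * norm x \<le> N x"
proof -
  have N0: "0 \<le> N x" and Nz: "N x = 0 \<longleftrightarrow> x = 0" and Ns: "N (c *\<^sub>R x) = \<bar>c\<bar> * N x"
    and Nt: "N (x + y) \<le> N x + N y" for c x y
    using assms unfolding is_norm_def by blast+
  define B where "B = (\<Sum>b\<in>Basis. N b)"
  have Nsum: "N (\<Sum>i\<in>S. h i) \<le> (\<Sum>i\<in>S. N (h i))" if "finite S" for S and h :: "'a \<Rightarrow> 'a"
    using that
  proof (induction S)
    case empty
    then show ?case using Nz[of 0] by simp
  next
    case (insert i S)
    then show ?case using Nt[of "h i" "\<Sum>i\<in>S. h i"] by simp
  qed
  have upper: "N x \<le> B * norm x" for x
  proof -
    have "N x = N (\<Sum>b\<in>Basis. (x \<bullet> b) *\<^sub>R b)" by (simp add: euclidean_representation)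
    also have "\<dots> \<le> (\<Sum>b\<in>Basis. \<bar>x \<bullet> b\<bar> * N b)"
      using Nsum[of Basis "\<lambda>b. (x \<bullet> b) *\<^sub>R b"] by (simp add: Ns)
    also have "\<dots> \<le> (\<Sum>b\<in>Basis. norm x * N b)"
      by (intro sum_mono mult_right_mono Basis_le_norm N0)
    finally show ?thesis by (simp add: B_def sum_distrib_left mult.commute)
  qed
  have Nm: "N (x - y) = N (y - x)" for x y
    using Ns[of "-1" "x - y"] by simp
  have diff: "\<bar>N x - N y\<bar> \<le> B * norm (x - y)" for x y
    using Nt[of "x - y" y] Nt[of "y - x" x] upper[of "x - y"] Nm[of x y] by simp
  have "B-lipschitz_on UNIV N"
    using diff N0 by (intro lipschitz_onI) (auto simp: dist_norm B_def intro: sum_nonneg)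
  then have cont: "continuous_on UNIV N" by (rule lipschitz_on_continuous_on)
  obtain b :: 'a where "b \<in> Basis" using nonempty_Basis by blast
  then have "b \<in> sphere 0 1" by simp
  then have "sphere (0::'a) 1 \<noteq> {}" by blast
  then obtain a where a: "a \<in> sphere 0 1" and amin: "\<And>x. x \<in> sphere 0 1 \<Longrightarrow> N a \<le> N x"
    using continuous_attains_inf[OF compact_sphere _ continuous_on_subset[OF cont], of 0 1] by auto
  have "N a > 0" using a Nz[of a] N0[of a] by force
  moreover have "N a * norm x \<le> N x" for x
  proof (cases "x = 0")
    case True
    then show ?thesis using N0 by simp
  next
    case False
    then have "N a \<le> N ((1 / norm x) *\<^sub>R x)" by (intro amin) simp
    then show ?thesis using False by (simp add: Ns field_simps)
  qed
  ultimately show ?thesis using that by blast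
qed

lemma constraint_function_compact_sublevel:
  fixes N :: "'a::euclidean_space \<Rightarrow> real"
  assumes N: "is_norm N" and f: "constraint_function N f"
  shows "compact {x. f x \<le> r}"
proof -
  obtain g where "\<And>x. GDERIV f x :> g x" using f unfolding constraint_function_def by blast
  then have cont: "continuous_on UNIV f"
    unfolding gderiv_def by (intro has_derivative_continuous_on)
  have "closed {x. f x \<le> r}" by (rule closed_Collect_le[OF cont]) simp
  moreover have "bounded {x. f x \<le> r}"
  proof -
    have "filterlim f at_top (filtercomap N at_top)"
      using f unfolding constraint_function_def by blast
    then have "eventually (\<lambda>x. f x > r) (filtercomap N at_top)"
      by (simp add: filterlim_at_top_dense)
    then obtain M where M: "\<And>x. N x \<ge> M \<Longrightarrow> f x > r"
      unfolding eventually_filtercomap eventually_at_top_linorder by auto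
    obtain c where c: "c > 0" "\<And>x. c * norm x \<le> N x" by (rule is_norm_dominates_norm[OF N]) blast
    have "norm x \<le> M / c" if "f x \<le> r" for x
    proof -
      have "c * norm x \<le> M" using M[of x] c(2)[of x] that by force
      then show ?thesis using c(1) by (simp add: field_simps)
    qed
    then show ?thesis by (intro boundedI[where B = "M / c"]) auto
  qed
  ultimately show ?thesis by (simp add: compact_eq_bounded_closed)
qed

text \<open>Linear independence of the \<open>\<psi> j\<close> makes the weights coordinates on the activation space.\<close>

lemma is_norm_activation:
  fixes \<psi> :: "'w::finite \<Rightarrow> real \<Rightarrow> real"
  assumes "basis_functions s I \<psi>" "is_norm_on_functions (activation_space \<psi>) N"
  shows "is_norm (\<lambda>w. N (activation \<psi> w :: real^'m \<Rightarrow> real^'m))"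
proof -
  have in_space: "(activation \<psi> w :: real^'m \<Rightarrow> real^'m) \<in> activation_space \<psi>" for w
    by (simp add: activation_space_def)
  have scale: "activation \<psi> (c *\<^sub>R w) = (\<lambda>y::real^'m. c *\<^sub>R activation \<psi> w y)" for c w
    by (auto simp: activation_def vec_eq_iff sum_distrib_left mult.assoc)
  have add: "activation \<psi> (v + w) = (\<lambda>y::real^'m. activation \<psi> v y + activation \<psi> w y)" for v w
    by (auto simp: activation_def vec_eq_iff sum.distrib algebra_simps)
  have zero: "(\<forall>y. activation \<psi> w (y::real^'m) = 0) \<longleftrightarrow> w = 0" for w
  proof
    assume *: "\<forall>y. activation \<psi> w (y::real^'m) = 0"
    have "(\<Sum>j\<in>UNIV. w $ j * \<psi> j t) = 0" for t
      using *[rule_format, of "\<chi> i. t"] by (simp add: activation_def vec_eq_iff)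
    then show "w = 0" using assms(1) unfolding basis_functions_def by blast
  qed (simp add: activation_def vec_eq_iff)
  note N = assms(2)[unfolded is_norm_on_functions_def]
  show ?thesis
    unfolding is_norm_def scale add
  proof (intro conjI allI)
    fix c :: real and v w :: "real^'w"
    show "0 \<le> N (activation \<psi> w)" using N in_space by blast
    show "N (activation \<psi> w) = 0 \<longleftrightarrow> w = 0" using N in_space zero by metis
    show "N (\<lambda>y. c *\<^sub>R activation \<psi> w y) = \<bar>c\<bar> * N (activation \<psi> w)"
      using N in_space by blast
    show "N (\<lambda>y. activation \<psi> v y + activation \<psi> w y) \<le> N (activation \<psi> v) + N (activation \<psi> w)"
      using N in_space by blast
  qed
qed

section \<open>The network vector field\<close>

lemma Cs_function_continuous:
  assumes "Cs_function s f"
  shows "continuous_on UNIV f"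
proof (cases s)
  case 0
  then show ?thesis using assms by (simp add: Cs_function_def)
next
  case (Suc n)
  then have "\<forall>t. f field_differentiable (at t)"
    using assms unfolding Cs_function_def by (metis funpow_0 zero_less_Suc)
  then show ?thesis
    by (simp add: continuous_at_imp_continuous_on field_differentiable_imp_continuous_at)
qed

lemma basis_functions_continuous:
  "basis_functions s I \<psi> \<Longrightarrow> continuous_on UNIV (\<psi> j)"
  unfolding basis_functions_def using Cs_function_continuous by blast

lemma basis_functions_weighted_bounded:
  fixes \<psi> :: "'w::finite \<Rightarrow> real \<Rightarrow> real"
  assumes "basis_functions s I \<psi>"
  obtains M where "\<And>j t. \<bar>t * \<psi> j t\<bar> \<le> M"
proof -
  have "\<exists>M. \<forall>t. \<bar>t * \<psi> j t\<bar> \<le> M" for j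
  proof -
    let ?S = "closure {t. \<psi> j t \<noteq> 0}"
    have "compact ?S" using assms unfolding basis_functions_def by blast
    moreover have "continuous_on ?S (\<lambda>t. t * \<psi> j t)"
      by (intro continuous_intros continuous_on_subset[OF basis_functions_continuous[OF assms]]) auto
    ultimately have "bounded ((\<lambda>t. t * \<psi> j t) ` ?S)"
      by (intro compact_imp_bounded compact_continuous_image)
    then obtain M where "M > 0" and M: "\<And>t. t \<in> ?S \<Longrightarrow> \<bar>t * \<psi> j t\<bar> \<le> M"
      unfolding bounded_pos by auto
    have "\<bar>t * \<psi> j t\<bar> \<le> M" for t
    proof (cases "\<psi> j t = 0")
      case True
      then show ?thesis using \<open>M > 0\<close> by simp
    next
      case False
      then show ?thesis by (intro M subsetD[OF closure_subset]) simp
    qed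
    then show ?thesis by blast
  qed
  then obtain M where M: "\<And>j t. \<bar>t * \<psi> j t\<bar> \<le> M j" by metis
  have "0 \<le> M j" for j using M[of 0 j] by simp
  then have "M j \<le> (\<Sum>j\<in>UNIV. M j)" for j
    by (intro member_le_sum) auto
  then have "\<bar>t * \<psi> j t\<bar> \<le> (\<Sum>j\<in>UNIV. M j)" for j t
    using M order_trans by blast
  then show ?thesis using that by blast
qed

lemma continuous_on_matrix_vector_mult [continuous_intros]:
  fixes M :: "'a::topological_space \<Rightarrow> real^'n^'m"
  assumes "continuous_on S M" "continuous_on S v"
  shows "continuous_on S (\<lambda>p. M p *v v p)"
  unfolding matrix_vector_mult_def by (intro continuous_intros assms)

lemma continuous_on_transpose [continuous_intros]:
  fixes M :: "'a::topological_space \<Rightarrow> real^'n^'m"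
  assumes "continuous_on S M"
  shows "continuous_on S (\<lambda>p. transpose (M p))"
  unfolding transpose_def by (intro continuous_intros assms)

lemma continuous_on_activation:
  fixes w :: "'a::topological_space \<Rightarrow> real^'w" and v :: "'a \<Rightarrow> real^'m"
  assumes "\<And>j. continuous_on UNIV (\<psi> j)" "continuous_on S w" "continuous_on S v"
  shows "continuous_on S (\<lambda>p. activation \<psi> (w p) (v p))"
  unfolding activation_def
  by (intro continuous_intros assms continuous_on_compose2[OF assms(1)]) auto

lemma inner_transpose_matrix_vector:
  fixes M :: "real^'n^'m"
  shows "x \<bullet> (transpose M *v y) = (M *v x) \<bullet> y"
  by (metis dot_lmul_matrix vector_transpose_matrix)

text \<open>Activations enter through their weights and families through finite vectors, so that the
  controls range over a Euclidean space, where compactness can be checked.\<close>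

definition network_field ::
    "real^'n^'l \<Rightarrow> real^'l \<Rightarrow> ('w::finite \<Rightarrow> real \<Rightarrow> real) \<Rightarrow>
     real \<times> ((real^'n^'m)^'k) \<times> ((real^'w)^'k) \<Rightarrow> real^'n \<Rightarrow> real^'n" where
  "network_field A b \<psi> = (\<lambda>(T, K, W) y. T *\<^sub>R (- (transpose A *v (A *v y - b))
     - (\<Sum>k\<in>UNIV. transpose (K $ k) *v activation \<psi> (W $ k) (K $ k *v y))))"

lemma is_state_eq_trajectory:
  "is_state A b x0 T (\<lambda>k. K $ k) (\<lambda>k. activation \<psi> (W $ k)) =
    trajectory (network_field A b \<psi> (T, K, W)) x0"
  by (rule ext) (simp add: is_state_def trajectory_def network_field_def)

lemma continuous_on_network_field:
  assumes "\<And>j. continuous_on UNIV (\<psi> j)"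
  shows "continuous_on S (\<lambda>(p, y). network_field A b \<psi> p y)"
  unfolding network_field_def case_prod_beta
  by (intro continuous_intros continuous_on_activation assms)

text \<open>The quadratic part is dissipative, and the activations are multiplied by the very argument
  they are evaluated at, so only the bounds on \<open>t * \<psi> j t\<close> and on the weights enter; the bound is
  uniform in the matrices.\<close>

lemma radial_component_bounded:
  fixes A :: "real^'n^'l" and K :: "(real^'n^'m)^'k" and W :: "(real^'w::finite)^'k"
    and B M Tmax :: real
  assumes T: "0 \<le> T" "T \<le> Tmax" and W: "\<And>k. norm (W $ k) \<le> B"
    and M: "\<And>j t. \<bar>t * \<psi> j t\<bar> \<le> M"
  shows "y \<bullet> network_field A b \<psi> (T, K, W) y
      \<le> Tmax * ((norm b)\<^sup>2 + CARD('k) * (CARD('m) * (CARD('w) * (B * M))))"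
proof -
  have "0 \<le> B" using W[of undefined] norm_ge_zero order_trans by blast
  have "0 \<le> M" using M[of 0 undefined] by simp
  \<comment> \<open>This is \<open>y \<bullet> \<Phi> y\<close> summed over neurons and basis functions.\<close>
  have neuron: "\<bar>v \<bullet> activation \<psi> (W $ k) v\<bar> \<le> CARD('m) * (CARD('w) * (B * M))"
    for v :: "real^'m" and k
  proof -
    have "v \<bullet> activation \<psi> (W $ k) v = (\<Sum>i\<in>UNIV. \<Sum>j\<in>UNIV. W $ k $ j * (v $ i * \<psi> j (v $ i)))"
      by (simp add: inner_vec_def activation_def sum_distrib_left algebra_simps)
    also have "\<bar>\<dots>\<bar> \<le> (\<Sum>i\<in>(UNIV::'m set). \<Sum>j\<in>(UNIV::'w set). B * M)"
    proof (intro order_trans[OF sum_abs] sum_mono)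
      fix i j
      have "\<bar>W $ k $ j\<bar> \<le> B" using component_le_norm_cart[of "W $ k" j] W[of k] by simp
      then show "\<bar>W $ k $ j * (v $ i * \<psi> j (v $ i))\<bar> \<le> B * M"
        using M[of "v $ i" j] \<open>0 \<le> B\<close> unfolding abs_mult[of "W $ k $ j"] by (intro mult_mono) auto
    qed
    finally show ?thesis by simp
  qed
  have "- ((A *v y) \<bullet> (A *v y - b)) \<le> (norm b)\<^sup>2"
  proof -
    have "(A *v y) \<bullet> b \<le> (norm (A *v y) * norm b)" by (rule norm_cauchy_schwarz)
    moreover have "2 * (norm (A *v y) * norm b) \<le> (norm (A *v y))\<^sup>2 + (norm b)\<^sup>2"
      using sum_squares_bound[of "norm (A *v y)" "norm b"] by simp
    moreover have "0 \<le> (norm (A *v y))\<^sup>2" "0 \<le> (norm b)\<^sup>2" by simp_all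
    moreover have "(A *v y) \<bullet> (A *v y - b) = (norm (A *v y))\<^sup>2 - (A *v y) \<bullet> b"
      by (simp add: inner_diff_right power2_norm_eq_inner)
    ultimately show ?thesis by linarith
  qed
  moreover have "- (\<Sum>k\<in>UNIV. (K $ k *v y) \<bullet> activation \<psi> (W $ k) (K $ k *v y))
      \<le> CARD('k) * (CARD('m) * (CARD('w) * (B * M)))"
  proof -
    have "(\<Sum>k\<in>UNIV. - ((K $ k *v y) \<bullet> activation \<psi> (W $ k) (K $ k *v y)))
        \<le> (\<Sum>k\<in>(UNIV::'k set). CARD('m) * (CARD('w) * (B * M)))"
      by (intro sum_mono) (use neuron abs_le_D2 in blast)
    then show ?thesis by (simp add: sum_negf)
  qed
  ultimately have bound: "y \<bullet> (- (transpose A *v (A *v y - b))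
      - (\<Sum>k\<in>UNIV. transpose (K $ k) *v activation \<psi> (W $ k) (K $ k *v y)))
      \<le> (norm b)\<^sup>2 + CARD('k) * (CARD('m) * (CARD('w) * (B * M)))"
    by (simp add: inner_diff_right inner_sum_right inner_transpose_matrix_vector
        del: transpose_matrix_vector)
  have "0 \<le> (norm b)\<^sup>2 + CARD('k) * (CARD('m) * (CARD('w) * (B * M)))"
    using \<open>0 \<le> B\<close> \<open>0 \<le> M\<close> by simp
  then show ?thesis
    unfolding network_field_def prod.case inner_scaleR_right
    by (rule order_trans[OF mult_left_mono[OF bound T(1)] mult_right_mono[OF T(2)]])
qed

section \<open>Admissible controls\<close>

lemma compact_vec_power:
  fixes S :: "'a::euclidean_space set"
  assumes "compact S"
  shows "compact {v :: 'a^'k. \<forall>k. v $ k \<in> S}"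
proof -
  obtain B where B: "\<And>x. x \<in> S \<Longrightarrow> norm x \<le> B"
    using compact_imp_bounded[OF assms] unfolding bounded_iff by blast
  have "norm v \<le> CARD('k) * B" if "\<forall>k. v $ k \<in> S" for v :: "'a^'k"
  proof -
    have "norm v \<le> (\<Sum>k\<in>UNIV. norm (v $ k))"
      unfolding norm_vec_def by (rule L2_set_le_sum) simp
    also have "\<dots> \<le> (\<Sum>k\<in>(UNIV::'k set). B)" using that B by (intro sum_mono) auto
    finally show ?thesis by simp
  qed
  then have "bounded {v :: 'a^'k. \<forall>k. v $ k \<in> S}" unfolding bounded_iff by blast
  moreover have "closed {v :: 'a^'k. \<forall>k. v $ k \<in> S}"
  proof -
    have "closed ((\<lambda>v :: 'a^'k. v $ k) -` S)" for k
      by (intro closed_vimage compact_imp_closed[OF assms] continuous_intros)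
    then have "closed (\<Inter>k. (\<lambda>v :: 'a^'k. v $ k) -` S)" by blast
    moreover have "(\<Inter>k. (\<lambda>v :: 'a^'k. v $ k) -` S) = {v. \<forall>k. v $ k \<in> S}" by auto
    ultimately show ?thesis by simp
  qed
  ultimately show ?thesis by (simp add: compact_eq_bounded_closed)
qed

theorem theorem2p1:
  fixes s :: nat
    and A :: "real^'n^'l" and b :: "real^'l" and x0 xg :: "real^'n"
    and Tmax :: real
    and I :: "real set" and \<psi> :: "'w::finite \<Rightarrow> real \<Rightarrow> real"
    and normK \<alpha> :: "real^'n^'m \<Rightarrow> real"
    and normV \<beta> :: "(real^'m \<Rightarrow> real^'m) \<Rightarrow> real"
  assumes "0 < Tmax"
    and "is_interval I" and "open I" and "bounded I"
    and "basis_functions s I \<psi>"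
    and "is_norm normK"
    and "is_norm_on_functions (activation_space \<psi>) normV"
    and "constraint_function normK \<alpha>"
    and "activation_constraint_function \<psi> normV \<beta>"
    and feasible: "\<exists>T (K :: 'k::finite \<Rightarrow> real^'n^'m) \<Phi>.
                     admissible_controls \<psi> Tmax \<alpha> \<beta> T K \<Phi>"
  shows "\<exists>T (K :: 'k \<Rightarrow> real^'n^'m) \<Phi> x.
           admissible_controls \<psi> Tmax \<alpha> \<beta> T K \<Phi> \<and> is_state A b x0 T K \<Phi> x \<and>
           (\<forall>T' (K' :: 'k \<Rightarrow> real^'n^'m) \<Phi>' x'.
              admissible_controls \<psi> Tmax \<alpha> \<beta> T' K' \<Phi>' \<and> is_state A b x0 T' K' \<Phi>' x' \<longrightarrow>
              cost xg x \<le> cost xg x')"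
proof -
  define SK where "SK = {M. \<alpha> M \<le> 1} \<inter> {M. M *v vec 1 = 0}"
  define SW where "SW = {w. \<beta> (activation \<psi> w) \<le> 1}"
  define P where "P = {0..Tmax} \<times> {K :: (real^'n^'m)^'k. \<forall>k. K $ k \<in> SK}
                        \<times> {W :: (real^'w)^'k. \<forall>k. W $ k \<in> SW}"
  have "closed {M :: real^'n^'m. M *v vec 1 = 0}"
    by (intro closed_Collect_eq continuous_intros)
  then have SK: "compact SK"
    unfolding SK_def using constraint_function_compact_sublevel[OF assms(6) assms(8)]
    by (intro compact_Int_closed)
  have SW: "compact SW"
    unfolding SW_def
    by (intro constraint_function_compact_sublevel[OF is_norm_activation[OF assms(5) assms(7)]]
        assms(9)[unfolded activation_constraint_function_def])
  have P: "compact P"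
    unfolding P_def by (intro compact_Times compact_vec_power SK SW compact_Icc)
  have admissibleI: "admissible_controls \<psi> Tmax \<alpha> \<beta> T (\<lambda>k. K $ k) (\<lambda>k. activation \<psi> (W $ k))"
    if "(T, K, W) \<in> P" for T K W
    using that by (auto simp: P_def SK_def SW_def admissible_controls_def activation_space_def)
  have admissibleE: "\<exists>K' W'. K = (\<lambda>k. K' $ k) \<and> \<Phi> = (\<lambda>k. activation \<psi> (W' $ k)) \<and> (T, K', W') \<in> P"
    if adm: "admissible_controls \<psi> Tmax \<alpha> \<beta> T K \<Phi>" for T and K :: "'k \<Rightarrow> real^'n^'m" and \<Phi>
  proof -
    have "\<forall>k. \<exists>w. \<Phi> k = activation \<psi> w"
      using adm by (auto simp: admissible_controls_def activation_space_def)
    then obtain W where W: "\<And>k. \<Phi> k = activation \<psi> (W k)" by metis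
    then have \<Phi>: "\<Phi> = (\<lambda>k. activation \<psi> (W k))" by blast
    show ?thesis
      using adm unfolding \<Phi>
      by (intro exI[of _ "\<chi> k. K k"] exI[of _ "\<chi> k. W k"])
         (auto simp: P_def SK_def SW_def admissible_controls_def)
  qed
  obtain B where B: "\<And>w. w \<in> SW \<Longrightarrow> norm w \<le> B"
    using compact_imp_bounded[OF SW] unfolding bounded_iff by blast
  obtain M where M: "\<And>j t. \<bar>t * \<psi> j t\<bar> \<le> M"
    by (rule basis_functions_weighted_bounded[OF assms(5)]) blast
  let ?f = "network_field A b \<psi> :: real \<times> ((real^'n^'m)^'k) \<times> ((real^'w)^'k) \<Rightarrow> _"
  let ?E = "{x 1 | p x. p \<in> P \<and> trajectory (?f p) x0 x}"
  have "compact ?E"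
  proof (rule compact_reachable_set[OF P])
    show "continuous_on (P \<times> UNIV) (\<lambda>(p, y). ?f p y)"
      by (rule continuous_on_network_field[OF basis_functions_continuous[OF assms(5)]])
    show "y \<bullet> ?f p y \<le> Tmax * ((norm b)\<^sup>2 + CARD('k) * (CARD('m) * (CARD('w) * (B * M))))"
      if "p \<in> P" for p y
    proof (cases p)
      case (fields T K W)
      then show ?thesis using that radial_component_bounded[of T Tmax W B \<psi> M y A b K] B M
        by (auto simp: P_def)
    qed
  qed
  moreover have "?E \<noteq> {}"
  proof -
    obtain T K W where TKW: "(T, K, W) \<in> P" using feasible admissibleE by blast
    \<comment> \<open>Setting the horizon to \<open>0\<close> freezes the dynamics, so a state exists.\<close>
    then have "(0, K, W) \<in> P" using \<open>0 < Tmax\<close> by (auto simp: P_def)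
    moreover have "trajectory (?f (0, K, W)) x0 (\<lambda>_. x0)"
      by (simp add: trajectory_def network_field_def)
    ultimately show ?thesis by blast
  qed
  moreover have "continuous_on ?E (\<lambda>e. 1 / 2 * (norm (e - xg))\<^sup>2)"
    by (intro continuous_intros)
  ultimately obtain e where "e \<in> ?E"
    and min: "\<forall>e'\<in>?E. 1 / 2 * (norm (e - xg))\<^sup>2 \<le> 1 / 2 * (norm (e' - xg))\<^sup>2"
    using continuous_attains_inf[of ?E] by blast
  then obtain T K W x where TKW: "(T, K, W) \<in> P" and x: "trajectory (?f (T, K, W)) x0 x"
    and e: "e = x 1" by auto
  show ?thesis
  proof (intro exI conjI allI impI)
    show "admissible_controls \<psi> Tmax \<alpha> \<beta> T (\<lambda>k. K $ k) (\<lambda>k. activation \<psi> (W $ k))"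
      by (rule admissibleI[OF TKW])
    show "is_state A b x0 T (\<lambda>k. K $ k) (\<lambda>k. activation \<psi> (W $ k)) x"
      using x by (simp add: is_state_eq_trajectory)
    fix T' and K' :: "'k \<Rightarrow> real^'n^'m" and \<Phi>' x'
    assume *: "admissible_controls \<psi> Tmax \<alpha> \<beta> T' K' \<Phi>' \<and> is_state A b x0 T' K' \<Phi>' x'"
    then obtain L V where "K' = (\<lambda>k. L $ k)" "\<Phi>' = (\<lambda>k. activation \<psi> (V $ k))" "(T', L, V) \<in> P"
      using admissibleE by blast
    then have "x' 1 \<in> ?E" using * by (auto simp: is_state_eq_trajectory)
    then show "cost xg x \<le> cost xg x'" using min by (simp add: cost_def e)
  qed
qed

end
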